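(* Let $G=G_+G_-$ be a unique factorization of a finite group $G$, and let $R(\xi,\eta)$ be a normal positive quasitriangular structure on the Hopf algebra $H(G;G_+,G_-)$ over $\mathbb{C}$. Then $R(\xi,\eta)$ is pseudotriangular if and only if $\eta(uv)=\eta(vu)$ for all $u,v\in G_+$.
   Context: The base field is $\mathbb{C}$. A unique factorization $G=G_+G_-$ of a group $G$ (with unit $e$) consists of two subgroups $G_+,G_-$ such that every $g\in G$ can be written uniquely as $g=g_+g_-$ with $g_+\in G_+$, $g_-\in G_-$; then every $g$ can also be written uniquely as $g=\overline{g}_-\overline{g}_+$ with $\overline{g}_-\in G_-$, $\overline{g}_+\in G_+$. For $u\in G_+$, $x\in G_-$, write uniquely $$xu=({}^xu)(x^u),\ {}^xu\in G_+,\ x^u\in G_-;\qquad ux=({}^ux)(u^x),\ {}^ux\in G_-,\ u^x\in G_+.$$ For $G$ finite, $H(G;G_+,G_-)$ is the Hopf algebra with basis $\{g\}$, $g\in G$, and structure: multiplication $\{g\}\{h\}=\delta_{g_+^{g_-},h_+}\{gh_-\}$; unit $1=\sum_{g_+\in G_+}\{g_+\}$; comultiplication $\Delta(\{g\})=\sum_{h_+\in G_+}\{g_+h_+^{-1}({}^{h_+}g_-)\}\otimes\{h_+g_-\}$; counit $\varepsilon(\{g\})=\delta_{g_+,e}$; antipode $S(\{g\})=\{g^{-1}\}$. A quasitriangular structure on $H(G;G_+,G_-)$ is positive if its coefficients in the basis $\{g\}\otimes\{h\}$ are nonnegative reals. It is known (Lu–Yan–Zhu) that the positive quasitriangular structures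 are exactly the elements $$R(\xi,\eta)=\sum_{u,v\in G_+}\{u(\eta(v)^u)^{-1}\}\otimes\{v\xi(u)\},$$ where $\xi,\eta:G_+\to G_-$ are group homomorphisms satisfying, for all $u,v\in G_+$ and $x\in G_-$: $\xi(u)^v=\xi(u^{\eta(v)})$, ${}^u\eta(v)=\eta({}^{\xi(u)}v)$, $uv=({}^{\xi(u)}v)(u^{\eta(v)})$, $\xi({}^xu)x^u=x\xi(u)$, $\eta({}^xu)x^u=x\eta(u)$. The structure $R(\xi,\eta)$ is called normal if $\xi(u)=e$ for all $u\in G_+$. A quasitriangular structure $R\in H\otimes H$ on a Hopf algebra $H$ is called pseudotriangular if $R_{12}R^{-1}_{31}R_{23}=R_{23}R^{-1}_{31}R_{12}$ in $H^{\otimes 3}$, where for $Q=\sum a\otimes b$ one writes $Q_{12}=\sum a\otimes b\otimes 1$, $Q_{23}=\sum 1\otimes a\otimes b$, $Q_{31}=\sum b\otimes 1\otimes a$, and $R^{-1}_{31}=(R^{-1})_{31}$. *)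

theory Defs
  imports Complex_Main "HOL-Algebra.Group"
begin

section \<open>Algebras and Hopf algebras with a distinguished finite basis over the complex numbers\<close>

text \<open>
  An element of an algebra with finite basis \<open>B\<close> is encoded by its coordinate function, a function
  to the complex numbers that vanishes outside \<open>B\<close>. The structure maps are given by their values on
  basis elements and extended (bi)linearly.
\<close>

record 'b based_algebra =
  basis :: "'b set"
  basis_mult :: "'b \<Rightarrow> 'b \<Rightarrow> 'b \<Rightarrow> complex"
  unit_elt :: "'b \<Rightarrow> complex"

record 'b based_hopf = "'b based_algebra" +
  basis_comult :: "'b \<Rightarrow> 'b \<times> 'b \<Rightarrow> complex"
  basis_counit :: "'b \<Rightarrow> complex"
  basis_antipode :: "'b \<Rightarrow> 'b \<Rightarrow> complex"

definition single :: "'b \<Rightarrow> 'b \<Rightarrow> complex" where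
  "single b = (\<lambda>x. if x = b then 1 else 0)"

definition elements :: "('b, 'm) based_algebra_scheme \<Rightarrow> ('b \<Rightarrow> complex) set" where
  "elements A = {f. \<forall>b. b \<notin> basis A \<longrightarrow> f b = 0}"

definition alg_mult ::
  "('b, 'm) based_algebra_scheme \<Rightarrow> ('b \<Rightarrow> complex) \<Rightarrow> ('b \<Rightarrow> complex) \<Rightarrow> 'b \<Rightarrow> complex" where
  "alg_mult A f g = (\<lambda>k. \<Sum>a\<in>basis A. \<Sum>b\<in>basis A. f a * g b * basis_mult A a b k)"

definition is_inverse ::
  "('b, 'm) based_algebra_scheme \<Rightarrow> ('b \<Rightarrow> complex) \<Rightarrow> ('b \<Rightarrow> complex) \<Rightarrow> bool" where
  "is_inverse A f g \<longleftrightarrow> g \<in> elements A \<and> alg_mult A f g = unit_elt A \<and> alg_mult A g f = unit_elt A"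

definition alg_inverse :: "('b, 'm) based_algebra_scheme \<Rightarrow> ('b \<Rightarrow> complex) \<Rightarrow> 'b \<Rightarrow> complex" where
  "alg_inverse A f = (THE g. is_inverse A f g)"

definition tensor_alg ::
  "('b, 'm) based_algebra_scheme \<Rightarrow> ('c, 'n) based_algebra_scheme \<Rightarrow> ('b \<times> 'c) based_algebra" where
  "tensor_alg A B =
    \<lparr>basis = basis A \<times> basis B,
     basis_mult = (\<lambda>(a, b) (a', b') (a'', b''). basis_mult A a a' a'' * basis_mult B b b' b''),
     unit_elt = (\<lambda>(a, b). unit_elt A a * unit_elt B b)\<rparr>"

abbreviation tensor2 :: "('b, 'm) based_algebra_scheme \<Rightarrow> ('b \<times> 'b) based_algebra" where
  "tensor2 H \<equiv> tensor_alg H H"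

abbreviation tensor3 :: "('b, 'm) based_algebra_scheme \<Rightarrow> ('b \<times> 'b \<times> 'b) based_algebra" where
  "tensor3 H \<equiv> tensor_alg H (tensor_alg H H)"

text \<open>
  For \<open>Q = \<Sum> a \<otimes> b\<close>: \<open>leg12 H Q = \<Sum> a \<otimes> b \<otimes> 1\<close>, \<open>leg23 H Q = \<Sum> 1 \<otimes> a \<otimes> b\<close>,
  \<open>leg13 H Q = \<Sum> a \<otimes> 1 \<otimes> b\<close>, \<open>leg31 H Q = \<Sum> b \<otimes> 1 \<otimes> a\<close>.
\<close>

definition leg12 :: "('b, 'm) based_algebra_scheme \<Rightarrow> ('b \<times> 'b \<Rightarrow> complex) \<Rightarrow> 'b \<times> 'b \<times> 'b \<Rightarrow> complex" where
  "leg12 H Q = (\<lambda>(x, y, z). Q (x, y) * unit_elt H z)"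

definition leg23 :: "('b, 'm) based_algebra_scheme \<Rightarrow> ('b \<times> 'b \<Rightarrow> complex) \<Rightarrow> 'b \<times> 'b \<times> 'b \<Rightarrow> complex" where
  "leg23 H Q = (\<lambda>(x, y, z). unit_elt H x * Q (y, z))"

definition leg13 :: "('b, 'm) based_algebra_scheme \<Rightarrow> ('b \<times> 'b \<Rightarrow> complex) \<Rightarrow> 'b \<times> 'b \<times> 'b \<Rightarrow> complex" where
  "leg13 H Q = (\<lambda>(x, y, z). Q (x, z) * unit_elt H y)"

definition leg31 :: "('b, 'm) based_algebra_scheme \<Rightarrow> ('b \<times> 'b \<Rightarrow> complex) \<Rightarrow> 'b \<times> 'b \<times> 'b \<Rightarrow> complex" where
  "leg31 H Q = (\<lambda>(x, y, z). Q (z, x) * unit_elt H y)"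

definition comult :: "('b, 'm) based_hopf_scheme \<Rightarrow> ('b \<Rightarrow> complex) \<Rightarrow> 'b \<times> 'b \<Rightarrow> complex" where
  "comult H f = (\<lambda>k. \<Sum>a\<in>basis H. f a * basis_comult H a k)"

definition op_comult :: "('b, 'm) based_hopf_scheme \<Rightarrow> ('b \<Rightarrow> complex) \<Rightarrow> 'b \<times> 'b \<Rightarrow> complex" where
  "op_comult H f = (\<lambda>(x, y). comult H f (y, x))"

definition comult_left ::
  "('b, 'm) based_hopf_scheme \<Rightarrow> ('b \<times> 'b \<Rightarrow> complex) \<Rightarrow> 'b \<times> 'b \<times> 'b \<Rightarrow> complex" where
  \<comment> \<open>the map \<open>\<Delta> \<otimes> id\<close>\<close>
  "comult_left H Q = (\<lambda>(x, y, z). \<Sum>a\<in>basis H. Q (a, z) * basis_comult H a (x, y))"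

definition comult_right ::
  "('b, 'm) based_hopf_scheme \<Rightarrow> ('b \<times> 'b \<Rightarrow> complex) \<Rightarrow> 'b \<times> 'b \<times> 'b \<Rightarrow> complex" where
  \<comment> \<open>the map \<open>id \<otimes> \<Delta>\<close>\<close>
  "comult_right H Q = (\<lambda>(x, y, z). \<Sum>a\<in>basis H. Q (x, a) * basis_comult H a (y, z))"

definition quasitriangular :: "('b, 'm) based_hopf_scheme \<Rightarrow> ('b \<times> 'b \<Rightarrow> complex) \<Rightarrow> bool" where
  "quasitriangular H R \<longleftrightarrow>
     R \<in> elements (tensor2 H) \<and>
     (\<exists>R'. is_inverse (tensor2 H) R R') \<and>
     (\<forall>f\<in>elements H. alg_mult (tensor2 H) (op_comult H f) R = alg_mult (tensor2 H) R (comult H f)) \<and>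
     comult_left H R = alg_mult (tensor3 H) (leg13 H R) (leg23 H R) \<and>
     comult_right H R = alg_mult (tensor3 H) (leg13 H R) (leg12 H R)"

definition pseudotriangular :: "('b, 'm) based_hopf_scheme \<Rightarrow> ('b \<times> 'b \<Rightarrow> complex) \<Rightarrow> bool" where
  "pseudotriangular H R \<longleftrightarrow>
     quasitriangular H R \<and>
     (let mul = alg_mult (tensor3 H); R' = alg_inverse (tensor2 H) R in
       mul (mul (leg12 H R) (leg31 H R')) (leg23 H R) =
       mul (mul (leg23 H R) (leg31 H R')) (leg12 H R))"

section \<open>Unique factorizations of groups\<close>

locale unique_factorization = group G + plus: subgroup Gp G + minus: subgroup Gm G
  for G (structure) and Gp and Gm +
  assumes ex1_factorization: "g \<in> carrier G \<Longrightarrow> \<exists>!p. p \<in> Gp \<times> Gm \<and> g = fst p \<otimes> snd p"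

text \<open>\<open>g = g\<^sub>+ g\<^sub>-\<close> with parts \<open>plus_part\<close>, \<open>minus_part\<close>, and in the opposite order
  \<open>g = h\<^sub>- h\<^sub>+\<close> with parts \<open>bar_minus_part\<close>, \<open>bar_plus_part\<close>.\<close>

definition plus_part where
  "plus_part G Gp Gm g = (THE a. a \<in> Gp \<and> (\<exists>x\<in>Gm. g = a \<otimes>\<^bsub>G\<^esub> x))"

definition minus_part where
  "minus_part G Gp Gm g = (THE x. x \<in> Gm \<and> (\<exists>a\<in>Gp. g = a \<otimes>\<^bsub>G\<^esub> x))"

definition bar_minus_part where
  "bar_minus_part G Gp Gm g = (THE x. x \<in> Gm \<and> (\<exists>a\<in>Gp. g = x \<otimes>\<^bsub>G\<^esub> a))"

definition bar_plus_part where
  "bar_plus_part G Gp Gm g = (THE a. a \<in> Gp \<and> (\<exists>x\<in>Gm. g = x \<otimes>\<^bsub>G\<^esub> a))"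

text \<open>
  For \<open>u\<close> in \<open>Gp\<close> and \<open>x\<close> in \<open>Gm\<close>, the equations \<open>x u = (\<^sup>xu) (x\<^sup>u)\<close> and \<open>u x = (\<^sup>ux) (u\<^sup>x)\<close>
  read \<open>x u = minus_on_plus x u \<cdot> minus_by_plus x u\<close> and
  \<open>u x = plus_on_minus u x \<cdot> plus_by_minus u x\<close>: the names with \<open>on\<close> are the left actions
  and those with \<open>by\<close> the right actions.
\<close>

definition minus_on_plus where
  "minus_on_plus G Gp Gm x u = plus_part G Gp Gm (x \<otimes>\<^bsub>G\<^esub> u)"

definition minus_by_plus where
  "minus_by_plus G Gp Gm x u = minus_part G Gp Gm (x \<otimes>\<^bsub>G\<^esub> u)"

definition plus_on_minus where
  "plus_on_minus G Gp Gm u x = bar_minus_part G Gp Gm (u \<otimes>\<^bsub>G\<^esub> x)"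

definition plus_by_minus where
  "plus_by_minus G Gp Gm u x = bar_plus_part G Gp Gm (u \<otimes>\<^bsub>G\<^esub> x)"

definition factorization_hopf ::
  "('a, 'm) monoid_scheme \<Rightarrow> 'a set \<Rightarrow> 'a set \<Rightarrow> 'a based_hopf" where
  "factorization_hopf G Gp Gm =
    \<lparr>basis = carrier G,
     basis_mult = (\<lambda>g h.
       if plus_by_minus G Gp Gm (plus_part G Gp Gm g) (minus_part G Gp Gm g) = plus_part G Gp Gm h
       then single (g \<otimes>\<^bsub>G\<^esub> minus_part G Gp Gm h) else (\<lambda>_. 0)),
     unit_elt = (\<lambda>k. \<Sum>u\<in>Gp. single u k),
     basis_comult = (\<lambda>g k. \<Sum>h\<in>Gp.
       single (plus_part G Gp Gm g \<otimes>\<^bsub>G\<^esub> inv\<^bsub>G\<^esub> h \<otimes>\<^bsub>G\<^esub> plus_on_minus G Gp Gm h (minus_part G Gp Gm g),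
               h \<otimes>\<^bsub>G\<^esub> minus_part G Gp Gm g) k),
     basis_counit = (\<lambda>g. if plus_part G Gp Gm g = \<one>\<^bsub>G\<^esub> then 1 else 0),
     basis_antipode = (\<lambda>g. single (inv\<^bsub>G\<^esub> g))\<rparr>"

section \<open>The positive quasitriangular structures\<close>

definition R_mat ::
  "('a, 'm) monoid_scheme \<Rightarrow> 'a set \<Rightarrow> 'a set \<Rightarrow> ('a \<Rightarrow> 'a) \<Rightarrow> ('a \<Rightarrow> 'a) \<Rightarrow> 'a \<times> 'a \<Rightarrow> complex" where
  "R_mat G Gp Gm \<xi> \<eta> = (\<lambda>k. \<Sum>u\<in>Gp. \<Sum>v\<in>Gp.
     single (u \<otimes>\<^bsub>G\<^esub> inv\<^bsub>G\<^esub> (minus_by_plus G Gp Gm (\<eta> v) u), v \<otimes>\<^bsub>G\<^esub> \<xi> u) k)"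

text \<open>
  The conditions of Lu, Yan and Zhu on a pair \<open>(\<xi>, \<eta>)\<close>. By their theorem, the elements \<open>R_mat\<close> of
  such pairs are exactly the quasitriangular structures whose coefficients in the basis
  \<open>{g} \<otimes> {h}\<close> are nonnegative reals.
\<close>

locale positive_quasitriangular_pair = unique_factorization G Gp Gm
  for G (structure) and Gp and Gm and \<xi> and \<eta> +
  assumes xi_hom: "\<xi> \<in> hom (G\<lparr>carrier := Gp\<rparr>) (G\<lparr>carrier := Gm\<rparr>)"
    and eta_hom: "\<eta> \<in> hom (G\<lparr>carrier := Gp\<rparr>) (G\<lparr>carrier := Gm\<rparr>)"
    and xi_by: "\<lbrakk>u \<in> Gp; v \<in> Gp\<rbrakk> \<Longrightarrow>
      minus_by_plus G Gp Gm (\<xi> u) v = \<xi> (plus_by_minus G Gp Gm u (\<eta> v))"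
    and on_eta: "\<lbrakk>u \<in> Gp; v \<in> Gp\<rbrakk> \<Longrightarrow>
      plus_on_minus G Gp Gm u (\<eta> v) = \<eta> (minus_on_plus G Gp Gm (\<xi> u) v)"
    and commutation: "\<lbrakk>u \<in> Gp; v \<in> Gp\<rbrakk> \<Longrightarrow>
      u \<otimes> v = minus_on_plus G Gp Gm (\<xi> u) v \<otimes> plus_by_minus G Gp Gm u (\<eta> v)"
    and xi_equivariant: "\<lbrakk>u \<in> Gp; x \<in> Gm\<rbrakk> \<Longrightarrow>
      \<xi> (minus_on_plus G Gp Gm x u) \<otimes> minus_by_plus G Gp Gm x u = x \<otimes> \<xi> u"
    and eta_equivariant: "\<lbrakk>u \<in> Gp; x \<in> Gm\<rbrakk> \<Longrightarrow>
      \<eta> (minus_on_plus G Gp Gm x u) \<otimes> minus_by_plus G Gp Gm x u = x \<otimes> \<eta> u"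

definition normal_pair where
  "normal_pair G Gp \<xi> \<longleftrightarrow> (\<forall>u\<in>Gp. \<xi> u = \<one>\<^bsub>G\<^esub>)"

end

theory Submission
  imports Defs "HOL-Library.Indicator_Function"
begin

text \<open>
  For trivial \<open>\<xi>\<close> the conditions on \<open>(\<xi>, \<eta>)\<close> collapse. Equivariance of \<open>\<xi>\<close> makes \<open>G\<^sub>+\<close> normal, so that
  \<open>G\<close> is a semidirect product, and the other conditions say that \<open>\<eta>\<close> is a crossed module:
  it commutes with conjugation by \<open>G\<^sub>-\<close>, and \<open>\<eta> v\<close> conjugates \<open>G\<^sub>+\<close> in the same way as \<open>v\<close> does
  (\<open>normal_pair_crossed_module\<close>).

  The Hopf algebra is then the algebra of the action groupoid of \<open>G\<^sub>-\<close> on \<open>G\<^sub>+\<close>, the basis element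
  \<open>u x\<close> being an arrow from \<open>u\<close> to \<open>x\<inverse> u x\<close>, and its tensor powers are the algebras of the powers
  of this groupoid. All the elements that matter are sums, with coefficients \<open>1\<close>, over a set of
  arrows with distinct sources, that is, over a partial section of the source map. Two such sums
  multiply by following the unique composable arrow (\<open>section_mult\<close>), and two sections give the
  same sum only if they agree at every source (\<open>section_eq_iff\<close>). Every identity in a tensor
  power thus becomes an identity in \<open>G\<close>, one for each object \<open>(a, b)\<close> or \<open>(a, b, c)\<close>.

  The structure \<open>R\<close> sends \<open>(a, b)\<close> to \<open>(a (\<eta> b)\<inverse>, b)\<close>, and \<open>R\<inverse>\<close> sends it to
  \<open>(a \<eta> b, b)\<close>. Put \<open>w = b a b\<inverse>\<close>. At \<open>(a, b, c)\<close> the two sides of the pseudotriangular equation are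
  \<open>(a (\<eta> b)\<inverse>, b (\<eta> (w\<inverse> c w))\<inverse>, c \<eta> w)\<close> and \<open>(a (\<eta> (c b c\<inverse>))\<inverse>, b (\<eta> c)\<inverse>, c \<eta> a)\<close>. They agree
  everywhere exactly when \<open>\<eta>\<close> is constant on the conjugacy classes of \<open>G\<^sub>+\<close>
  (\<open>pseudotriangular_iff_conj\<close>), which is the condition \<open>\<eta> (u v) = \<eta> (v u)\<close>. The same calculus
  shows that \<open>R\<close> is quasitriangular, which the notion of pseudotriangularity includes.
\<close>

section \<open>Algebras of finite categories\<close>

lemma single_eq_indicator: "single b = indicator {b}"
  by (auto simp: single_def fun_eq_iff)

lemma sum_single_eq_indicator:
  assumes "finite I" "inj_on F I"
  shows "(\<Sum>i\<in>I. single (F i) k) = indicator (F ` I) k"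
proof (cases "k \<in> F ` I")
  case True
  then obtain i where i: "i \<in> I" "k = F i" by blast
  have "(\<Sum>j\<in>I. single (F j) k) = (\<Sum>j\<in>I. if j = i then 1 else 0)"
    using i assms(2) by (intro sum.cong) (auto simp: single_def inj_on_def)
  then show ?thesis using i assms(1) by simp
next
  case False
  then show ?thesis by (auto simp: single_def intro!: sum.neutral)
qed

lemma alg_mult_sum_left:
  "alg_mult A (\<lambda>d. \<Sum>i\<in>I. c i * \<phi> i d) h k = (\<Sum>i\<in>I. c i * alg_mult A (\<phi> i) h k)"
proof -
  have "alg_mult A (\<lambda>d. \<Sum>i\<in>I. c i * \<phi> i d) h k
      = (\<Sum>a\<in>basis A. \<Sum>b\<in>basis A. \<Sum>i\<in>I. c i * (\<phi> i a * h b * basis_mult A a b k))"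
    by (simp add: alg_mult_def sum_distrib_right mult.assoc)
  also have "\<dots> = (\<Sum>a\<in>basis A. \<Sum>i\<in>I. \<Sum>b\<in>basis A. c i * (\<phi> i a * h b * basis_mult A a b k))"
    by (intro sum.cong refl sum.swap)
  also have "\<dots> = (\<Sum>i\<in>I. \<Sum>a\<in>basis A. \<Sum>b\<in>basis A. c i * (\<phi> i a * h b * basis_mult A a b k))"
    by (rule sum.swap)
  finally show ?thesis by (simp add: alg_mult_def sum_distrib_left)
qed

lemma alg_mult_sum_right:
  "alg_mult A h (\<lambda>d. \<Sum>i\<in>I. c i * \<phi> i d) k = (\<Sum>i\<in>I. c i * alg_mult A h (\<phi> i) k)"
proof -
  have "alg_mult A h (\<lambda>d. \<Sum>i\<in>I. c i * \<phi> i d) k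
      = (\<Sum>a\<in>basis A. \<Sum>b\<in>basis A. \<Sum>i\<in>I. c i * (h a * \<phi> i b * basis_mult A a b k))"
    by (simp add: alg_mult_def sum_distrib_right sum_distrib_left mult_ac)
  also have "\<dots> = (\<Sum>a\<in>basis A. \<Sum>i\<in>I. \<Sum>b\<in>basis A. c i * (h a * \<phi> i b * basis_mult A a b k))"
    by (intro sum.cong refl sum.swap)
  also have "\<dots> = (\<Sum>i\<in>I. \<Sum>a\<in>basis A. \<Sum>b\<in>basis A. c i * (h a * \<phi> i b * basis_mult A a b k))"
    by (rule sum.swap)
  finally show ?thesis by (simp add: alg_mult_def sum_distrib_left)
qed

text \<open>
  The basis consists of the arrows of a finite category, with composition written in diagrammatic
  order, and arrows that do not compose multiply to zero.
\<close>

locale category_algebra =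
  fixes A :: "('b, 'm) based_algebra_scheme"
    and Obj :: "'o set" and src tgt :: "'b \<Rightarrow> 'o"
    and cmp :: "'b \<Rightarrow> 'b \<Rightarrow> 'b" and idn :: "'o \<Rightarrow> 'b"
  assumes finite_basis: "finite (basis A)"
    and basis_mult_eq: "\<lbrakk>a \<in> basis A; b \<in> basis A\<rbrakk> \<Longrightarrow>
      basis_mult A a b = (if tgt a = src b then single (cmp a b) else (\<lambda>_. 0))"
    and src_in: "a \<in> basis A \<Longrightarrow> src a \<in> Obj"
    and tgt_in: "a \<in> basis A \<Longrightarrow> tgt a \<in> Obj"
    and idn_in: "i \<in> Obj \<Longrightarrow> idn i \<in> basis A"
    and src_idn: "i \<in> Obj \<Longrightarrow> src (idn i) = i"
    and tgt_idn: "i \<in> Obj \<Longrightarrow> tgt (idn i) = i"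
    and cmp_in: "\<lbrakk>a \<in> basis A; b \<in> basis A; tgt a = src b\<rbrakk> \<Longrightarrow> cmp a b \<in> basis A"
    and src_cmp: "\<lbrakk>a \<in> basis A; b \<in> basis A; tgt a = src b\<rbrakk> \<Longrightarrow> src (cmp a b) = src a"
    and tgt_cmp: "\<lbrakk>a \<in> basis A; b \<in> basis A; tgt a = src b\<rbrakk> \<Longrightarrow> tgt (cmp a b) = tgt b"
    and cmp_assoc: "\<lbrakk>a \<in> basis A; b \<in> basis A; c \<in> basis A; tgt a = src b; tgt b = src c\<rbrakk> \<Longrightarrow>
      cmp (cmp a b) c = cmp a (cmp b c)"
    and idn_cmp: "a \<in> basis A \<Longrightarrow> cmp (idn (src a)) a = a"
    and cmp_idn: "a \<in> basis A \<Longrightarrow> cmp a (idn (tgt a)) = a"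
    and unit_elt_eq: "unit_elt A = indicator (idn ` Obj)"
begin

lemma sum_single_left:
  assumes "x \<in> basis A"
  shows "(\<Sum>d\<in>basis A. single x d * \<phi> d) = \<phi> x"
proof -
  have "(\<Sum>d\<in>basis A. single x d * \<phi> d) = (\<Sum>d\<in>basis A. if d = x then \<phi> d else 0)"
    by (intro sum.cong) (auto simp: single_def)
  then show ?thesis using assms finite_basis by simp
qed

lemma basis_mult_assoc:
  assumes "a \<in> basis A" "b \<in> basis A" "c \<in> basis A"
  shows "(\<Sum>d\<in>basis A. basis_mult A a b d * basis_mult A d c k)
       = (\<Sum>d\<in>basis A. basis_mult A b c d * basis_mult A a d k)"
proof -
  have "(\<Sum>d\<in>basis A. basis_mult A a b d * basis_mult A d c k)
      = (if tgt a = src b \<and> tgt b = src c then single (cmp (cmp a b) c) k else 0)"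
    using assms by (simp add: basis_mult_eq sum_single_left cmp_in tgt_cmp)
  moreover have "(\<Sum>d\<in>basis A. basis_mult A b c d * basis_mult A a d k)
      = (if tgt a = src b \<and> tgt b = src c then single (cmp a (cmp b c)) k else 0)"
    using assms by (simp add: basis_mult_eq sum_single_left cmp_in src_cmp)
  ultimately show ?thesis using assms by (simp add: cmp_assoc)
qed

text \<open>
  Associativity makes inverses unique, so that the definite description \<open>alg_inverse\<close> can be
  evaluated by exhibiting an inverse.
\<close>

lemma alg_mult_assoc: "alg_mult A (alg_mult A f g) h = alg_mult A f (alg_mult A g h)"
proof
  fix k
  let ?B = "basis A" and ?m = "basis_mult A"
  have prod: "alg_mult A p q = (\<lambda>d. \<Sum>i\<in>?B \<times> ?B. (p (fst i) * q (snd i)) * ?m (fst i) (snd i) d)" for p q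
    by (simp add: alg_mult_def sum.cartesian_product split_beta)
  have l: "alg_mult A (?m a b) h k = (\<Sum>c\<in>?B. h c * (\<Sum>d\<in>?B. ?m a b d * ?m d c k))" for a b
    unfolding alg_mult_def by (subst sum.swap) (simp add: sum_distrib_left mult_ac)
  have r: "alg_mult A f (?m b c) k = (\<Sum>a\<in>?B. f a * (\<Sum>d\<in>?B. ?m b c d * ?m a d k))" for b c
    unfolding alg_mult_def by (simp add: sum_distrib_left mult_ac)
  have "alg_mult A (alg_mult A f g) h k
      = (\<Sum>a\<in>?B. \<Sum>b\<in>?B. f a * g b * (\<Sum>c\<in>?B. h c * (\<Sum>d\<in>?B. ?m a b d * ?m d c k)))"
    by (subst prod[of f g]) (simp add: alg_mult_sum_left l sum.cartesian_product split_beta)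
  also have "\<dots> = (\<Sum>a\<in>?B. \<Sum>b\<in>?B. f a * g b * (\<Sum>c\<in>?B. h c * (\<Sum>d\<in>?B. ?m b c d * ?m a d k)))"
    by (intro sum.cong refl) (simp add: basis_mult_assoc cong: sum.cong)
  also have "\<dots> = (\<Sum>a\<in>?B. \<Sum>b\<in>?B. \<Sum>c\<in>?B. g b * h c * (f a * (\<Sum>d\<in>?B. ?m b c d * ?m a d k)))"
    by (simp add: sum_distrib_left mult_ac)
  also have "\<dots> = (\<Sum>b\<in>?B. \<Sum>a\<in>?B. \<Sum>c\<in>?B. g b * h c * (f a * (\<Sum>d\<in>?B. ?m b c d * ?m a d k)))"
    by (rule sum.swap)
  also have "\<dots> = (\<Sum>b\<in>?B. \<Sum>c\<in>?B. \<Sum>a\<in>?B. g b * h c * (f a * (\<Sum>d\<in>?B. ?m b c d * ?m a d k)))"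
    by (intro sum.cong refl sum.swap)
  also have "\<dots> = (\<Sum>b\<in>?B. \<Sum>c\<in>?B. g b * h c * (\<Sum>a\<in>?B. f a * (\<Sum>d\<in>?B. ?m b c d * ?m a d k)))"
    by (simp add: sum_distrib_left)
  also have "\<dots> = alg_mult A f (alg_mult A g h) k"
    by (subst prod[of g h]) (simp add: alg_mult_sum_right r sum.cartesian_product split_beta)
  finally show "alg_mult A (alg_mult A f g) h k = alg_mult A f (alg_mult A g h) k" .
qed

lemma alg_mult_single_single:
  assumes "a \<in> basis A" "b \<in> basis A"
  shows "alg_mult A (single a) (single b) = basis_mult A a b"
  using assms by (simp add: alg_mult_def fun_eq_iff mult.assoc sum_single_left flip: sum_distrib_left)

lemma finite_Obj: "finite Obj"
  by (metis finite_basis finite_imageI finite_subset idn_in src_idn image_eqI subsetI)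

text \<open>The domain \<open>D\<close> may be a proper subset of the objects: coproducts of basis elements give such sections.\<close>

definition is_section :: "'o set \<Rightarrow> ('o \<Rightarrow> 'b) \<Rightarrow> bool" where
  "is_section D F \<longleftrightarrow> D \<subseteq> Obj \<and> (\<forall>i\<in>D. F i \<in> basis A \<and> src (F i) = i)"

lemma is_section_inj: "is_section D F \<Longrightarrow> inj_on F D"
  by (auto simp: is_section_def intro: inj_on_inverseI[of _ src])

lemma section_elements: "is_section D F \<Longrightarrow> indicator (F ` D) \<in> elements A"
  by (auto simp: is_section_def elements_def indicator_def)

lemma section_indicator:
  assumes "is_section D F"
  shows "indicator (F ` D) = (\<lambda>k. \<Sum>i\<in>D. 1 * single (F i) k)"
  using assms finite_subset[OF _ finite_Obj, of D]
  by (simp add: sum_single_eq_indicator is_section_inj fun_eq_iff is_section_def)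

text \<open>
  After the arrow \<open>F i\<close> the second section offers at most one arrow that composes with it, namely
  the one at the object \<open>tgt (F i)\<close>. Composites for different \<open>i\<close> have different
  sources, so no coefficient exceeds \<open>1\<close>.
\<close>

lemma section_mult:
  assumes F: "is_section D F" and F': "is_section D' F'"
  shows "alg_mult A (indicator (F ` D)) (indicator (F' ` D')) =
    indicator ((\<lambda>i. cmp (F i) (F' (tgt (F i)))) ` {i \<in> D. tgt (F i) \<in> D'})"
proof
  fix k
  let ?E = "{i \<in> D. tgt (F i) \<in> D'}" and ?C = "\<lambda>i. cmp (F i) (F' (tgt (F i)))"
  have fin: "finite D" "finite D'"
    using F F' finite_subset[OF _ finite_Obj] by (auto simp: is_section_def)
  have C: "is_section ?E ?C"
    using F F' by (auto simp: is_section_def cmp_in src_cmp)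
  have "alg_mult A (indicator (F ` D)) (indicator (F' ` D')) k
      = (\<Sum>i\<in>D. \<Sum>j\<in>D'. basis_mult A (F i) (F' j) k)"
    using F F' unfolding section_indicator[OF F] section_indicator[OF F']
    by (subst alg_mult_sum_left, subst alg_mult_sum_right)
       (simp add: alg_mult_single_single is_section_def)
  also have "\<dots> = (\<Sum>i\<in>D. \<Sum>j\<in>D'. if j = tgt (F i) then single (?C i) k else 0)"
    using F F' by (intro sum.cong refl) (auto simp: is_section_def basis_mult_eq)
  also have "\<dots> = (\<Sum>i\<in>D. if tgt (F i) \<in> D' then single (?C i) k else 0)"
    using fin by simp
  also have "\<dots> = (\<Sum>i\<in>?E. single (?C i) k)"
    using fin by (simp add: sum.inter_filter)
  also have "\<dots> = indicator (?C ` ?E) k"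
    using fin is_section_inj[OF C] by (simp add: sum_single_eq_indicator)
  finally show "alg_mult A (indicator (F ` D)) (indicator (F' ` D')) k = indicator (?C ` ?E) k" .
qed

lemma section_eq_iff:
  assumes "is_section D F" "is_section D F'"
  shows "(indicator (F ` D) :: 'b \<Rightarrow> complex) = indicator (F' ` D) \<longleftrightarrow> (\<forall>i\<in>D. F i = F' i)"
proof
  assume eq: "(indicator (F ` D) :: 'b \<Rightarrow> complex) = indicator (F' ` D)"
  show "\<forall>i\<in>D. F i = F' i"
  proof
    fix i assume i: "i \<in> D"
    have "indicator (F' ` D) (F i) = (1::complex)"
      using i fun_cong[OF eq, of "F i"] by simp
    then obtain j where "j \<in> D" "F i = F' j"
      by (auto simp: indicator_def split: if_splits)
    then show "F i = F' i" using assms i by (metis is_section_def)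
  qed
qed (simp cong: image_cong_simp)

lemma is_section_idn: "is_section Obj idn"
  by (auto simp: is_section_def idn_in src_idn)

lemma elements_expansion:
  assumes "f \<in> elements A"
  shows "f = (\<lambda>k. \<Sum>a\<in>basis A. f a * single a k)"
proof
  fix k
  have "(\<Sum>a\<in>basis A. f a * single a k) = (\<Sum>a\<in>basis A. if a = k then f a else 0)"
    by (intro sum.cong) (auto simp: single_def)
  then show "f k = (\<Sum>a\<in>basis A. f a * single a k)"
    using assms finite_basis by (auto simp: elements_def)
qed

lemma is_section_single: "a \<in> basis A \<Longrightarrow> is_section {src a} (\<lambda>_. a)"
  by (auto simp: is_section_def src_in)

text \<open>Basis elements are themselves sections, over one object; this reduces the unit laws to \<open>section_mult\<close>.\<close>

lemma unit_mult:
  assumes "f \<in> elements A" shows "alg_mult A (unit_elt A) f = f"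
proof
  fix k
  have "alg_mult A (unit_elt A) (single a) = single a" if a: "a \<in> basis A" for a
  proof -
    have "{i \<in> Obj. tgt (idn i) \<in> {src a}} = {src a}"
      using a by (auto simp: tgt_idn src_in)
    then show ?thesis
      using section_mult[OF is_section_idn is_section_single[OF a]] a
      by (simp add: unit_elt_eq single_eq_indicator idn_cmp)
  qed
  then show "alg_mult A (unit_elt A) f k = f k"
    by (subst (1 2) elements_expansion[OF assms]) (simp add: alg_mult_sum_right)
qed

lemma mult_unit:
  assumes "f \<in> elements A" shows "alg_mult A f (unit_elt A) = f"
proof
  fix k
  have "alg_mult A (single a) (unit_elt A) = single a" if a: "a \<in> basis A" for a
    using section_mult[OF is_section_single[OF a] is_section_idn] a
    by (simp add: unit_elt_eq single_eq_indicator cmp_idn tgt_in)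
  then show "alg_mult A f (unit_elt A) k = f k"
    by (subst (1 2) elements_expansion[OF assms]) (simp add: alg_mult_sum_left)
qed

lemma alg_inverse_eq:
  assumes "is_inverse A f g" shows "alg_inverse A f = g"
  unfolding alg_inverse_def
proof (rule the_equality)
  show "is_inverse A f g" by (rule assms)
next
  fix g' assume g': "is_inverse A f g'"
  have "g' = alg_mult A g' (alg_mult A f g)"
    using assms g' by (simp add: is_inverse_def mult_unit)
  also have "\<dots> = alg_mult A (alg_mult A g' f) g"
    by (simp only: alg_mult_assoc)
  also have "\<dots> = g"
    using assms g' by (simp add: is_inverse_def unit_mult)
  finally show "g' = g" .
qed

end

definition pair_cmp :: "('b \<Rightarrow> 'b \<Rightarrow> 'b) \<Rightarrow> ('c \<Rightarrow> 'c \<Rightarrow> 'c) \<Rightarrow> 'b \<times> 'c \<Rightarrow> 'b \<times> 'c \<Rightarrow> 'b \<times> 'c" where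
  "pair_cmp p q = (\<lambda>(a, b) (a', b'). (p a a', q b b'))"

lemma basis_tensor_alg [simp]: "basis (tensor_alg A B) = basis A \<times> basis B"
  by (simp add: tensor_alg_def)

lemma category_algebra_tensor:
  assumes "category_algebra A Obj src tgt cmp idn" "category_algebra B Obj' src' tgt' cmp' idn'"
  shows "category_algebra (tensor_alg A B) (Obj \<times> Obj') (map_prod src src') (map_prod tgt tgt')
    (pair_cmp cmp cmp') (map_prod idn idn')"
proof -
  interpret A: category_algebra A Obj src tgt cmp idn by (rule assms(1))
  interpret B: category_algebra B Obj' src' tgt' cmp' idn' by (rule assms(2))
  show ?thesis
  proof
    fix a b assume "a \<in> basis (tensor_alg A B)" "b \<in> basis (tensor_alg A B)"
    then show "basis_mult (tensor_alg A B) a b =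
      (if map_prod tgt tgt' a = map_prod src src' b then single (pair_cmp cmp cmp' a b) else (\<lambda>_. 0))"
      by (cases a; cases b)
        (simp add: tensor_alg_def pair_cmp_def A.basis_mult_eq B.basis_mult_eq single_def fun_eq_iff)
  next
    show "unit_elt (tensor_alg A B) = indicator (map_prod idn idn' ` (Obj \<times> Obj'))"
      by (auto simp: tensor_alg_def A.unit_elt_eq B.unit_elt_eq indicator_def fun_eq_iff)
  qed (auto simp: tensor_alg_def pair_cmp_def A.finite_basis B.finite_basis A.src_in B.src_in
      A.tgt_in B.tgt_in A.idn_in B.idn_in A.src_idn B.src_idn A.tgt_idn B.tgt_idn A.cmp_in B.cmp_in
      A.src_cmp B.src_cmp A.tgt_cmp B.tgt_cmp A.cmp_assoc B.cmp_assoc A.idn_cmp B.idn_cmp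
      A.cmp_idn B.cmp_idn)
qed

section \<open>Normal structures as crossed modules\<close>

context unique_factorization
begin

lemma factorization_unique:
  assumes "u \<in> Gp" "x \<in> Gm" "v \<in> Gp" "y \<in> Gm" "u \<otimes> x = v \<otimes> y"
  shows "u = v" "x = y"
proof -
  have "(u, x) = (v, y)"
    using assms ex1_factorization[of "u \<otimes> x"] by (metis SigmaI fst_conv snd_conv m_closed
        minus.mem_carrier plus.mem_carrier)
  then show "u = v" "x = y" by auto
qed

lemma factorization_eq_iff:
  "\<lbrakk>u \<in> Gp; x \<in> Gm; v \<in> Gp; y \<in> Gm\<rbrakk> \<Longrightarrow> u \<otimes> x = v \<otimes> y \<longleftrightarrow> u = v \<and> x = y"
  "\<lbrakk>u \<in> Gp; x \<in> Gm; v \<in> Gp\<rbrakk> \<Longrightarrow> u \<otimes> x = v \<longleftrightarrow> u = v \<and> x = \<one>"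
  using factorization_unique[of u x v y] factorization_unique[of u x v \<one>] by auto

lemma bar_factorization_unique:
  assumes "u \<in> Gp" "x \<in> Gm" "v \<in> Gp" "y \<in> Gm" "x \<otimes> u = y \<otimes> v"
  shows "u = v" "x = y"
proof -
  have "inv u \<otimes> inv x = inv v \<otimes> inv y"
    using assms by (metis inv_mult_group minus.mem_carrier plus.mem_carrier)
  then have "inv u = inv v" "inv x = inv y"
    using factorization_unique[of "inv u" "inv x" "inv v" "inv y"] assms by auto
  then show "u = v" "x = y" using assms by (metis inv_inv minus.mem_carrier plus.mem_carrier)+
qed

lemma parts_mult [simp]:
  assumes "u \<in> Gp" "x \<in> Gm"
  shows "plus_part G Gp Gm (u \<otimes> x) = u" "minus_part G Gp Gm (u \<otimes> x) = x"
  unfolding plus_part_def minus_part_def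
  by (rule the_equality; use assms in \<open>auto dest: factorization_unique\<close>)+

lemma bar_parts_mult:
  assumes "u \<in> Gp" "x \<in> Gm"
  shows "bar_plus_part G Gp Gm (x \<otimes> u) = u" "bar_minus_part G Gp Gm (x \<otimes> u) = x"
  unfolding bar_plus_part_def bar_minus_part_def
  by (rule the_equality; use assms in \<open>auto dest: bar_factorization_unique\<close>)+

lemma parts_plus [simp]:
  assumes "u \<in> Gp"
  shows "plus_part G Gp Gm u = u" "minus_part G Gp Gm u = \<one>"
  using parts_mult[OF assms minus.one_closed] assms by simp_all

lemma carrier_cases:
  assumes "g \<in> carrier G"
  obtains u x where "u \<in> Gp" "x \<in> Gm" "g = u \<otimes> x"
proof -
  from ex1_factorization[OF assms] obtain p where "p \<in> Gp \<times> Gm" "g = fst p \<otimes> snd p"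
    by blast
  then show thesis by (intro that[of "fst p" "snd p"]) auto
qed

end

text \<open>
  What remains of a normal pair: a crossed module \<open>\<eta>\<close> from the normal subgroup \<open>Gp\<close> to its
  complement \<open>Gm\<close>, which acts on \<open>Gp\<close> by conjugation in \<open>G\<close>.
\<close>

locale crossed_module_factorization = unique_factorization G Gp Gm
  for G (structure) and Gp Gm +
  fixes \<eta>
  assumes finite_carrier: "finite (carrier G)"
    and conj_closed: "\<lbrakk>u \<in> Gp; x \<in> Gm\<rbrakk> \<Longrightarrow> x \<otimes> u \<otimes> inv x \<in> Gp"
    and eta_mult: "\<lbrakk>u \<in> Gp; v \<in> Gp\<rbrakk> \<Longrightarrow> \<eta> (u \<otimes> v) = \<eta> u \<otimes> \<eta> v"
    and eta_closed: "u \<in> Gp \<Longrightarrow> \<eta> u \<in> Gm"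
    and eta_conj: "\<lbrakk>u \<in> Gp; x \<in> Gm\<rbrakk> \<Longrightarrow> \<eta> (x \<otimes> u \<otimes> inv x) = x \<otimes> \<eta> u \<otimes> inv x"
    and peiffer: "\<lbrakk>u \<in> Gp; v \<in> Gp\<rbrakk> \<Longrightarrow> \<eta> v \<otimes> u \<otimes> inv (\<eta> v) = v \<otimes> u \<otimes> inv v"

text \<open>
  With \<open>\<xi>\<close> trivial, \<open>xi_equivariant\<close> reads \<open>x\<^sup>u = x\<close>, so \<open>x u x\<inverse>\<close> is the \<open>Gp\<close>-part of \<open>x u\<close> and
  \<open>Gp\<close> is normal. Then \<open>commutation\<close> becomes \<open>u v = v ((\<eta> v)\<inverse> u (\<eta> v))\<close>, the Peiffer identity, and
  \<open>eta_equivariant\<close> becomes compatibility with conjugation.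
\<close>

lemma normal_pair_crossed_module:
  assumes "finite (carrier G)" "positive_quasitriangular_pair G Gp Gm \<xi> \<eta>" "normal_pair G Gp \<xi>"
  shows "crossed_module_factorization G Gp Gm \<eta>"
proof -
  interpret positive_quasitriangular_pair G Gp Gm \<xi> \<eta> by (rule assms(2))
  have xi: "\<xi> u = \<one>\<^bsub>G\<^esub>" if "u \<in> Gp" for u
    using assms(3) that by (simp add: normal_pair_def)
  have conj: "x \<otimes>\<^bsub>G\<^esub> u \<otimes>\<^bsub>G\<^esub> inv\<^bsub>G\<^esub> x \<in> Gp \<and> minus_on_plus G Gp Gm x u = x \<otimes>\<^bsub>G\<^esub> u \<otimes>\<^bsub>G\<^esub> inv\<^bsub>G\<^esub> x
      \<and> minus_by_plus G Gp Gm x u = x" if "u \<in> Gp" "x \<in> Gm" for u x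
  proof -
    have "x \<otimes>\<^bsub>G\<^esub> u \<in> carrier G" using that by simp
    then obtain p y where p: "p \<in> Gp" "y \<in> Gm" "x \<otimes>\<^bsub>G\<^esub> u = p \<otimes>\<^bsub>G\<^esub> y"
      by (rule carrier_cases)
    have *: "minus_on_plus G Gp Gm x u = p" "minus_by_plus G Gp Gm x u = y"
      by (simp_all add: minus_on_plus_def minus_by_plus_def p)
    have "y = x"
      using xi_equivariant[OF that] that p by (simp add: * xi)
    moreover have "p = x \<otimes>\<^bsub>G\<^esub> u \<otimes>\<^bsub>G\<^esub> inv\<^bsub>G\<^esub> x"
      using p \<open>y = x\<close> that by (simp add: m_assoc)
    ultimately show ?thesis using * p by simp
  qed
  have by_minus: "plus_by_minus G Gp Gm u x = inv\<^bsub>G\<^esub> x \<otimes>\<^bsub>G\<^esub> u \<otimes>\<^bsub>G\<^esub> x" if "u \<in> Gp" "x \<in> Gm" for u x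
  proof -
    have "inv\<^bsub>G\<^esub> x \<otimes>\<^bsub>G\<^esub> u \<otimes>\<^bsub>G\<^esub> x \<in> Gp" using conj[of u "inv\<^bsub>G\<^esub> x"] that by simp
    moreover have "u \<otimes>\<^bsub>G\<^esub> x = x \<otimes>\<^bsub>G\<^esub> (inv\<^bsub>G\<^esub> x \<otimes>\<^bsub>G\<^esub> u \<otimes>\<^bsub>G\<^esub> x)"
      using that by (simp add: m_assoc[symmetric])
    ultimately show ?thesis using that by (simp add: plus_by_minus_def bar_parts_mult)
  qed
  have em: "\<eta> (u \<otimes>\<^bsub>G\<^esub> v) = \<eta> u \<otimes>\<^bsub>G\<^esub> \<eta> v" and ec: "\<eta> u \<in> Gm" if "u \<in> Gp" "v \<in> Gp" for u v
    using eta_hom that by (auto simp: hom_def)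
  have peiffer: "\<eta> v \<otimes>\<^bsub>G\<^esub> u \<otimes>\<^bsub>G\<^esub> inv\<^bsub>G\<^esub> \<eta> v = v \<otimes>\<^bsub>G\<^esub> u \<otimes>\<^bsub>G\<^esub> inv\<^bsub>G\<^esub> v" if uv: "u \<in> Gp" "v \<in> Gp" for u v
  proof -
    \<comment> \<open>\<open>commutation\<close> describes conjugation by \<open>(\<eta> v)\<inverse>\<close>; applied to \<open>v u v\<inverse>\<close> it yields the inverse direction.\<close>
    define w where "w = v \<otimes>\<^bsub>G\<^esub> u \<otimes>\<^bsub>G\<^esub> inv\<^bsub>G\<^esub> v"
    have w: "w \<in> Gp" using uv by (simp add: w_def)
    have e: "\<eta> v \<in> carrier G" using ec[OF uv(2) uv(2)] by simp
    have "v \<otimes>\<^bsub>G\<^esub> u = w \<otimes>\<^bsub>G\<^esub> v" using uv by (simp add: w_def m_assoc)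
    also have "\<dots> = v \<otimes>\<^bsub>G\<^esub> (inv\<^bsub>G\<^esub> \<eta> v \<otimes>\<^bsub>G\<^esub> w \<otimes>\<^bsub>G\<^esub> \<eta> v)"
      using commutation[OF w uv(2)] by_minus[OF w ec[OF uv(2) uv(2)]] conj[OF uv(2) minus.one_closed] uv w
      by (simp add: xi)
    finally have "u = inv\<^bsub>G\<^esub> \<eta> v \<otimes>\<^bsub>G\<^esub> w \<otimes>\<^bsub>G\<^esub> \<eta> v"
      using uv w e by simp
    then have "\<eta> v \<otimes>\<^bsub>G\<^esub> u \<otimes>\<^bsub>G\<^esub> inv\<^bsub>G\<^esub> \<eta> v = w"
      using uv w e by (simp add: m_assoc) (simp add: m_assoc[symmetric])
    then show ?thesis by (simp add: w_def)
  qed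
  show ?thesis
  proof (unfold_locales)
    fix u x assume ux: "u \<in> Gp" "x \<in> Gm"
    show "\<eta> (x \<otimes>\<^bsub>G\<^esub> u \<otimes>\<^bsub>G\<^esub> inv\<^bsub>G\<^esub> x) = x \<otimes>\<^bsub>G\<^esub> \<eta> u \<otimes>\<^bsub>G\<^esub> inv\<^bsub>G\<^esub> x"
      using eta_equivariant[OF ux] conj[OF ux] ux ec[of "x \<otimes>\<^bsub>G\<^esub> u \<otimes>\<^bsub>G\<^esub> inv\<^bsub>G\<^esub> x"] ec[of u]
      by (metis inv_solve_right m_closed minus.mem_carrier)
  qed (use assms conj em ec peiffer in auto)
qed


section \<open>The Hopf algebra as the algebra of an action groupoid\<close>

context crossed_module_factorization
begin

definition H where "H = factorization_hopf G Gp Gm"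

definition src where "src g = plus_part G Gp Gm g"

definition tgt where
  "tgt g = inv (minus_part G Gp Gm g) \<otimes> plus_part G Gp Gm g \<otimes> minus_part G Gp Gm g"

definition cmp where "cmp g h = g \<otimes> minus_part G Gp Gm h"

lemma inv_conj_closed: "\<lbrakk>u \<in> Gp; x \<in> Gm\<rbrakk> \<Longrightarrow> inv x \<otimes> u \<otimes> x \<in> Gp"
  using conj_closed[of u "inv x"] by simp

text \<open>Normality trivialises two of the four actions and turns the others into conjugation.\<close>

lemma plus_by_minus_eq:
  assumes "u \<in> Gp" "x \<in> Gm"
  shows "plus_by_minus G Gp Gm u x = inv x \<otimes> u \<otimes> x" "plus_on_minus G Gp Gm u x = x"
proof -
  have "u \<otimes> x = x \<otimes> (inv x \<otimes> u \<otimes> x)"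
    using assms by (simp add: m_assoc[symmetric])
  then show "plus_by_minus G Gp Gm u x = inv x \<otimes> u \<otimes> x" "plus_on_minus G Gp Gm u x = x"
    using assms inv_conj_closed by (simp_all add: plus_by_minus_def plus_on_minus_def bar_parts_mult)
qed

lemma minus_by_plus_eq:
  assumes "u \<in> Gp" "x \<in> Gm"
  shows "minus_by_plus G Gp Gm x u = x"
proof -
  have "x \<otimes> u = (x \<otimes> u \<otimes> inv x) \<otimes> x" using assms by (simp add: m_assoc)
  then show ?thesis
    using parts_mult(2)[OF conj_closed[OF assms] assms(2)] by (simp add: minus_by_plus_def)
qed

lemma parts_mult_mult [simp]:
  assumes "u \<in> Gp" "x \<in> Gm" "y \<in> Gm"
  shows "plus_part G Gp Gm (u \<otimes> x \<otimes> y) = u" "minus_part G Gp Gm (u \<otimes> x \<otimes> y) = x \<otimes> y"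
  using assms parts_mult[of u "x \<otimes> y"] by (simp_all add: m_assoc)

lemma src_mult [simp]: "\<lbrakk>u \<in> Gp; x \<in> Gm\<rbrakk> \<Longrightarrow> src (u \<otimes> x) = u"
  and tgt_mult: "\<lbrakk>u \<in> Gp; x \<in> Gm\<rbrakk> \<Longrightarrow> tgt (u \<otimes> x) = inv x \<otimes> u \<otimes> x"
  and cmp_mult [simp]: "\<lbrakk>v \<in> Gp; y \<in> Gm\<rbrakk> \<Longrightarrow> cmp g (v \<otimes> y) = g \<otimes> y"
  and src_plus [simp]: "u \<in> Gp \<Longrightarrow> src u = u"
  and tgt_plus [simp]: "u \<in> Gp \<Longrightarrow> tgt u = u"
  and cmp_plus [simp]: "\<lbrakk>g \<in> carrier G; v \<in> Gp\<rbrakk> \<Longrightarrow> cmp g v = g"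
  by (simp_all add: src_def tgt_def cmp_def)

lemma basis_H [simp]: "basis H = carrier G"
  by (simp add: H_def factorization_hopf_def)

lemma finite_Gp: "finite Gp"
  using finite_carrier plus.subset finite_subset by blast

lemma unit_elt_H: "unit_elt H = indicator Gp"
  using sum_single_eq_indicator[of Gp "\<lambda>u. u"]
  by (simp add: H_def factorization_hopf_def finite_Gp fun_eq_iff)

sublocale H: category_algebra H Gp src tgt cmp "\<lambda>u. u"
proof
  fix a b assume "a \<in> basis H" "b \<in> basis H"
  then show "basis_mult H a b = (if tgt a = src b then single (cmp a b) else (\<lambda>_. 0))"
    by (auto elim!: carrier_cases simp: H_def factorization_hopf_def plus_by_minus_eq tgt_mult)
next
  fix a b c assume "a \<in> basis H" "b \<in> basis H" "c \<in> basis H"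
  then show "cmp (cmp a b) c = cmp a (cmp b c)"
    by (auto elim!: carrier_cases simp: cmp_def m_assoc)
next
  fix a b assume "a \<in> basis H" "b \<in> basis H" "tgt a = src b"
  then show "src (cmp a b) = src a" "tgt (cmp a b) = tgt b"
    by (auto elim!: carrier_cases simp: src_def tgt_def cmp_def inv_mult_group m_assoc)
qed (auto elim!: carrier_cases simp: unit_elt_H finite_carrier tgt_mult inv_conj_closed)

sublocale T2: category_algebra "tensor2 H" "Gp \<times> Gp" "map_prod src src" "map_prod tgt tgt"
  "pair_cmp cmp cmp" "map_prod (\<lambda>u. u) (\<lambda>u. u)"
  by (intro category_algebra_tensor H.category_algebra_axioms)

sublocale T3: category_algebra "tensor3 H" "Gp \<times> Gp \<times> Gp"
  "map_prod src (map_prod src src)" "map_prod tgt (map_prod tgt tgt)"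
  "pair_cmp cmp (pair_cmp cmp cmp)" "map_prod (\<lambda>u. u) (map_prod (\<lambda>u. u) (\<lambda>u. u))"
  by (intro category_algebra_tensor H.category_algebra_axioms T2.category_algebra_axioms)

end

section \<open>The structure R and its hexagon identities\<close>

text \<open>The unit is the sum over all objects, so a unit tensor factor contributes a free variable.\<close>

lemma legs_indicator:
  assumes "unit_elt A = indicator U"
  shows "leg12 A (indicator ((\<lambda>(a, b). (f a b, b)) ` (U \<times> U)))
      = indicator ((\<lambda>(a, b, c). (f a b, b, c)) ` (U \<times> U \<times> U))"
    and "leg23 A (indicator ((\<lambda>(a, b). (f a b, b)) ` (U \<times> U)))
      = indicator ((\<lambda>(a, b, c). (a, f b c, c)) ` (U \<times> U \<times> U))"
    and "leg13 A (indicator ((\<lambda>(a, b). (f a b, b)) ` (U \<times> U)))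
      = indicator ((\<lambda>(a, b, c). (f a c, b, c)) ` (U \<times> U \<times> U))"
    and "leg31 A (indicator ((\<lambda>(a, b). (f a b, b)) ` (U \<times> U)))
      = indicator ((\<lambda>(a, b, c). (a, b, f c a)) ` (U \<times> U \<times> U))"
  by (auto simp: leg12_def leg23_def leg13_def leg31_def assms fun_eq_iff indicator_def image_iff)

context crossed_module_factorization
begin

lemma eta_in_carrier [simp]: "u \<in> Gp \<Longrightarrow> \<eta> u \<in> carrier G"
  using eta_closed by simp

lemma mult_inv_cancel:
  "\<lbrakk>a \<in> carrier G; x \<in> carrier G\<rbrakk> \<Longrightarrow> a \<otimes> inv x \<otimes> x = a"
  "\<lbrakk>a \<in> carrier G; x \<in> carrier G\<rbrakk> \<Longrightarrow> a \<otimes> x \<otimes> inv x = a"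
  by (simp_all add: m_assoc)

lemma eta_inv: "u \<in> Gp \<Longrightarrow> \<eta> (inv u) = inv (\<eta> u)"
proof -
  assume u: "u \<in> Gp"
  have "\<eta> \<one> \<otimes> \<eta> \<one> = \<eta> \<one>" using eta_mult[of \<one> \<one>] by simp
  then have "\<eta> \<one> = \<one>" by simp
  then show ?thesis
    using eta_mult[of "inv u" u] u by (simp add: inv_equality)
qed

text \<open>By the Peiffer identity the targets that occur do not mention \<open>\<eta>\<close>.\<close>

lemma tgt_eta:
  assumes "u \<in> Gp" "v \<in> Gp"
  shows "tgt (u \<otimes> inv (\<eta> v)) = v \<otimes> u \<otimes> inv v" "tgt (u \<otimes> \<eta> v) = inv v \<otimes> u \<otimes> v"
  using assms eta_closed peiffer[of u v] peiffer[of u "inv v"] by (simp_all add: tgt_mult eta_inv)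

definition R_elt where "R_elt = R_mat G Gp Gm (\<lambda>_. \<one>) \<eta>"

lemma R_elt_eq: "R_elt = indicator ((\<lambda>(u, v). (u \<otimes> inv (\<eta> v), v)) ` (Gp \<times> Gp))"
proof -
  have "R_elt k = (\<Sum>(u, v)\<in>Gp \<times> Gp. single (u \<otimes> inv (\<eta> v), v) k)" for k
    by (simp add: R_elt_def R_mat_def minus_by_plus_eq eta_closed sum.cartesian_product[symmetric])
  moreover have "inj_on (\<lambda>(u, v). (u \<otimes> inv (\<eta> v), v)) (Gp \<times> Gp)"
    by (auto simp: inj_on_def)
  ultimately show ?thesis
    using sum_single_eq_indicator[of "Gp \<times> Gp" "\<lambda>(u, v). (u \<otimes> inv (\<eta> v), v)"]
    by (simp add: fun_eq_iff finite_Gp split_beta)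
qed

text \<open>\<open>R\<close> leaves its second leg fixed, so replacing \<open>(\<eta> v)\<inverse>\<close> by \<open>\<eta> v\<close> undoes it.\<close>

definition R_inv where "R_inv = indicator ((\<lambda>(u, v). (u \<otimes> \<eta> v, v)) ` (Gp \<times> Gp))"

lemma R_sections:
  "T2.is_section (Gp \<times> Gp) (\<lambda>(u, v). (u \<otimes> inv (\<eta> v), v))"
  "T2.is_section (Gp \<times> Gp) (\<lambda>(u, v). (u \<otimes> \<eta> v, v))"
  by (auto simp: T2.is_section_def basis_tensor_alg eta_closed)

lemma R_inverse: "is_inverse (tensor2 H) R_elt R_inv"
proof -
  have "alg_mult (tensor2 H) R_elt R_inv = unit_elt (tensor2 H)"
    unfolding R_elt_eq R_inv_def T2.section_mult[OF R_sections] T2.unit_elt_eq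
    by (intro arg_cong[where f = indicator] image_cong)
      (auto simp: tgt_eta pair_cmp_def eta_closed mult_inv_cancel)
  moreover have "alg_mult (tensor2 H) R_inv R_elt = unit_elt (tensor2 H)"
    unfolding R_elt_eq R_inv_def T2.section_mult[OF R_sections(2,1)] T2.unit_elt_eq
    by (intro arg_cong[where f = indicator] image_cong)
      (auto simp: tgt_eta pair_cmp_def eta_closed mult_inv_cancel)
  ultimately show ?thesis
    unfolding is_inverse_def using T2.section_elements[OF R_sections(2)] by (simp add: R_inv_def)
qed

lemma basis_comult_eq:
  assumes "u \<in> Gp" "x \<in> Gm"
  shows "basis_comult H (u \<otimes> x)
    = indicator ((\<lambda>(a, b). (a \<otimes> x, b \<otimes> x)) ` {(a, b). a \<in> Gp \<and> b \<in> Gp \<and> a \<otimes> b = u})"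
proof -
  have "inj_on (\<lambda>h. (u \<otimes> inv h \<otimes> x, h \<otimes> x)) Gp"
    using assms by (auto simp: inj_on_def)
  then have "basis_comult H (u \<otimes> x) = indicator ((\<lambda>h. (u \<otimes> inv h \<otimes> x, h \<otimes> x)) ` Gp)"
    using assms sum_single_eq_indicator[of Gp "\<lambda>h. (u \<otimes> inv h \<otimes> x, h \<otimes> x)"]
    by (simp add: H_def factorization_hopf_def fun_eq_iff plus_by_minus_eq finite_Gp)
  moreover have "{(a, b). a \<in> Gp \<and> b \<in> Gp \<and> a \<otimes> b = u} = (\<lambda>h. (u \<otimes> inv h, h)) ` Gp"
    using assms by (auto simp: image_iff m_assoc)
  ultimately show ?thesis by (simp add: image_image)
qed

lemma comult_sections:
  assumes "u \<in> Gp" "x \<in> Gm"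
  shows "T2.is_section {(a, b). a \<in> Gp \<and> b \<in> Gp \<and> a \<otimes> b = u} (\<lambda>(a, b). (a \<otimes> x, b \<otimes> x))"
    "T2.is_section {(a, b). a \<in> Gp \<and> b \<in> Gp \<and> b \<otimes> a = u} (\<lambda>(a, b). (a \<otimes> x, b \<otimes> x))"
  using assms by (auto simp: T2.is_section_def basis_tensor_alg)

lemma op_basis_comult_eq:
  assumes "u \<in> Gp" "x \<in> Gm"
  shows "(\<lambda>(k, l). basis_comult H (u \<otimes> x) (l, k))
    = indicator ((\<lambda>(a, b). (a \<otimes> x, b \<otimes> x)) ` {(a, b). a \<in> Gp \<and> b \<in> Gp \<and> b \<otimes> a = u})"
  by (auto simp: basis_comult_eq[OF assms] fun_eq_iff indicator_def image_iff)

lemma inv_eta_conj: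
  assumes "a \<in> Gp" "b \<in> Gp" "x \<in> Gm"
  shows "a \<otimes> x \<otimes> inv (\<eta> (inv x \<otimes> b \<otimes> x)) = a \<otimes> inv (\<eta> b) \<otimes> x"
proof -
  have "x \<otimes> inv (\<eta> (inv x \<otimes> b \<otimes> x)) = inv (\<eta> b) \<otimes> x"
    using assms eta_conj[of b "inv x"]
    by (simp add: inv_mult_group m_assoc) (simp add: m_assoc[symmetric])
  then show ?thesis using assms inv_conj_closed by (simp add: m_assoc)
qed

text \<open>
  The section of \<open>\<Delta> g\<close> lives over the pairs with product \<open>u\<close>. The target of \<open>R\<close> at \<open>(a, b)\<close> is
  \<open>(b a b\<inverse>, b)\<close>, whose product is \<open>b a\<close>: this turns the domain of \<open>\<Delta> g\<close> into that of the opposite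
  coproduct.
\<close>

lemma R_intertwines_basis:
  assumes g: "g \<in> carrier G"
  shows "alg_mult (tensor2 H) (\<lambda>(k, l). basis_comult H g (l, k)) R_elt
    = alg_mult (tensor2 H) R_elt (basis_comult H g)"
proof -
  obtain u x where ux: "u \<in> Gp" "x \<in> Gm" "g = u \<otimes> x" using g by (rule carrier_cases)
  let ?D = "{(a, b). a \<in> Gp \<and> b \<in> Gp \<and> b \<otimes> a = u}"
  have "alg_mult (tensor2 H) (\<lambda>(k, l). basis_comult H g (l, k)) R_elt
    = indicator ((\<lambda>(a, b). (a \<otimes> inv (\<eta> b) \<otimes> x, b \<otimes> x)) ` ?D)"
    unfolding ux(3) op_basis_comult_eq[OF ux(1,2)] R_elt_eq
      T2.section_mult[OF comult_sections(2)[OF ux(1,2)] R_sections(1)]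
    using ux(1,2)
    by (intro arg_cong[where f = indicator] image_cong)
      (auto simp: tgt_mult pair_cmp_def eta_closed inv_conj_closed inv_eta_conj)
  moreover have "alg_mult (tensor2 H) R_elt (basis_comult H g)
    = indicator ((\<lambda>(a, b). (a \<otimes> inv (\<eta> b) \<otimes> x, b \<otimes> x)) ` ?D)"
    unfolding ux(3) basis_comult_eq[OF ux(1,2)] R_elt_eq
      T2.section_mult[OF R_sections(1) comult_sections(1)[OF ux(1,2)]]
    using ux(1,2)
    by (intro arg_cong[where f = indicator] image_cong)
      (auto simp: tgt_eta pair_cmp_def mult_inv_cancel)
  ultimately show ?thesis by simp
qed

lemma R_intertwines:
  "alg_mult (tensor2 H) (op_comult H f) R_elt = alg_mult (tensor2 H) R_elt (comult H f)"
proof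
  fix k
  have "op_comult H f = (\<lambda>k. \<Sum>g\<in>carrier G. f g * (\<lambda>(k, l). basis_comult H g (l, k)) k)"
    by (auto simp: op_comult_def comult_def)
  moreover have "comult H f = (\<lambda>k. \<Sum>g\<in>carrier G. f g * basis_comult H g k)"
    by (simp add: comult_def)
  ultimately show "alg_mult (tensor2 H) (op_comult H f) R_elt k = alg_mult (tensor2 H) R_elt (comult H f) k"
    by (simp add: alg_mult_sum_left alg_mult_sum_right R_intertwines_basis)
qed

text \<open>
  Each pair of basis elements occurs in the coproduct of at most one basis element, so the sums
  defining \<open>\<Delta> \<otimes> id\<close> and \<open>id \<otimes> \<Delta>\<close> reduce to single terms.
\<close>

lemma basis_comult_pointwise:
  assumes "g \<in> carrier G"
  shows "basis_comult H g (k, l) = (if k \<in> carrier G \<and> l \<in> carrier G \<and>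
    minus_part G Gp Gm k = minus_part G Gp Gm l \<and> g = plus_part G Gp Gm k \<otimes> l then 1 else 0)"
  (is "_ = (if ?P then 1 else 0)")
proof -
  obtain u x where ux: "u \<in> Gp" "x \<in> Gm" "g = u \<otimes> x" using assms by (rule carrier_cases)
  have "(k, l) \<in> (\<lambda>(a, b). (a \<otimes> x, b \<otimes> x)) ` {(a, b). a \<in> Gp \<and> b \<in> Gp \<and> a \<otimes> b = u} \<longleftrightarrow> ?P"
  proof
    assume ?P
    then obtain a b y where ab: "a \<in> Gp" "b \<in> Gp" "y \<in> Gm" "k = a \<otimes> y" "l = b \<otimes> y"
      by (auto elim!: carrier_cases)
    then have "u \<otimes> x = (a \<otimes> b) \<otimes> y" using \<open>?P\<close> ux by (simp add: m_assoc)
    then have "u = a \<otimes> b" "x = y"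
      using ux(1,2) ab(1-3) factorization_unique[of u x "a \<otimes> b" y] by auto
    then show "(k, l) \<in> (\<lambda>(a, b). (a \<otimes> x, b \<otimes> x)) ` {(a, b). a \<in> Gp \<and> b \<in> Gp \<and> a \<otimes> b = u}"
      using ab by auto
  qed (use ux in \<open>auto simp: m_assoc\<close>)
  then show ?thesis by (simp add: ux(3) basis_comult_eq[OF ux(1,2)] indicator_def)
qed

lemma comult_left_pointwise:
  "comult_left H Q (x, y, z) = (if x \<in> carrier G \<and> y \<in> carrier G \<and>
    minus_part G Gp Gm x = minus_part G Gp Gm y then Q (plus_part G Gp Gm x \<otimes> y, z) else 0)"
proof -
  have "x \<in> carrier G \<Longrightarrow> plus_part G Gp Gm x \<in> Gp" by (auto elim!: carrier_cases)
  then show ?thesis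
    by (auto simp: comult_left_def basis_comult_pointwise finite_carrier if_distrib[of "(*) _"] cong: if_cong)
qed

lemma comult_right_pointwise:
  "comult_right H Q (x, y, z) = (if y \<in> carrier G \<and> z \<in> carrier G \<and>
    minus_part G Gp Gm y = minus_part G Gp Gm z then Q (x, plus_part G Gp Gm y \<otimes> z) else 0)"
proof -
  have "y \<in> carrier G \<Longrightarrow> plus_part G Gp Gm y \<in> Gp" by (auto elim!: carrier_cases)
  then show ?thesis
    by (auto simp: comult_right_def basis_comult_pointwise finite_carrier if_distrib[of "(*) _"] cong: if_cong)
qed

lemma leg_sections:
  "T3.is_section (Gp \<times> Gp \<times> Gp) (\<lambda>(a, b, c). (a \<otimes> inv (\<eta> b), b, c))"
  "T3.is_section (Gp \<times> Gp \<times> Gp) (\<lambda>(a, b, c). (a, b \<otimes> inv (\<eta> c), c))"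
  "T3.is_section (Gp \<times> Gp \<times> Gp) (\<lambda>(a, b, c). (a \<otimes> inv (\<eta> c), b, c))"
  "T3.is_section (Gp \<times> Gp \<times> Gp) (\<lambda>(a, b, c). (a, b, c \<otimes> \<eta> a))"
  by (auto simp: T3.is_section_def basis_tensor_alg eta_closed)

text \<open>
  Expanding \<open>\<Delta>\<close> on the first leg of \<open>R\<close> copies \<open>(\<eta> c)\<inverse>\<close> to both parts, while expanding it on the second leg
  splits \<open>v\<close> as \<open>b c\<close>, where multiplicativity of \<open>\<eta>\<close> matches the product of the legs.
\<close>

lemma R_quasitriangular: "quasitriangular H R_elt"
proof -
  have "comult_left H R_elt (x, y, z) =
      indicator ((\<lambda>(a, b, c). (a \<otimes> inv (\<eta> c), b \<otimes> inv (\<eta> c), c)) ` (Gp \<times> Gp \<times> Gp)) (x, y, z)"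
    for x y z
  proof (cases "x \<in> carrier G \<and> y \<in> carrier G \<and> z \<in> Gp")
    case True
    then obtain a b s t where ab: "a \<in> Gp" "b \<in> Gp" "s \<in> Gm" "t \<in> Gm" "x = a \<otimes> s" "y = b \<otimes> t"
      by (auto elim!: carrier_cases)
    have "a \<otimes> (b \<otimes> t) = (a \<otimes> b) \<otimes> t" using ab(1-4) by (simp add: m_assoc)
    then show ?thesis using ab(1-4) True eta_closed unfolding ab(5,6)
      by (auto simp: comult_left_pointwise R_elt_eq indicator_def image_iff factorization_eq_iff)
  next
    case False
    then show ?thesis by (auto simp: comult_left_pointwise R_elt_eq indicator_def)
  qed
  then have left: "comult_left H R_elt =
      indicator ((\<lambda>(a, b, c). (a \<otimes> inv (\<eta> c), b \<otimes> inv (\<eta> c), c)) ` (Gp \<times> Gp \<times> Gp))"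
    by (simp add: fun_eq_iff)
  have "comult_right H R_elt (x, y, z) =
      indicator ((\<lambda>(a, b, c). (a \<otimes> inv (\<eta> (b \<otimes> c)), b, c)) ` (Gp \<times> Gp \<times> Gp)) (x, y, z)"
    for x y z
  proof (cases "y \<in> carrier G \<and> z \<in> carrier G")
    case True
    then obtain b c s t where bc: "b \<in> Gp" "c \<in> Gp" "s \<in> Gm" "t \<in> Gm" "y = b \<otimes> s" "z = c \<otimes> t"
      by (auto elim!: carrier_cases)
    have "b \<otimes> (c \<otimes> t) = (b \<otimes> c) \<otimes> t" using bc(1-4) by (simp add: m_assoc)
    then show ?thesis using bc(1-4) unfolding bc(5,6)
      by (auto simp: comult_right_pointwise R_elt_eq indicator_def image_iff factorization_eq_iff)
  next
    case False
    then show ?thesis by (auto simp: comult_right_pointwise R_elt_eq indicator_def)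
  qed
  then have right: "comult_right H R_elt =
      indicator ((\<lambda>(a, b, c). (a \<otimes> inv (\<eta> (b \<otimes> c)), b, c)) ` (Gp \<times> Gp \<times> Gp))"
    by (simp add: fun_eq_iff)
  have "alg_mult (tensor3 H) (leg13 H R_elt) (leg23 H R_elt) =
      indicator ((\<lambda>(a, b, c). (a \<otimes> inv (\<eta> c), b \<otimes> inv (\<eta> c), c)) ` (Gp \<times> Gp \<times> Gp))"
    unfolding R_elt_eq legs_indicator[OF unit_elt_H] T3.section_mult[OF leg_sections(3,2)]
    by (intro arg_cong[where f = indicator] image_cong)
      (auto simp: tgt_eta pair_cmp_def eta_closed)
  moreover have "alg_mult (tensor3 H) (leg13 H R_elt) (leg12 H R_elt) =
      indicator ((\<lambda>(a, b, c). (a \<otimes> inv (\<eta> (b \<otimes> c)), b, c)) ` (Gp \<times> Gp \<times> Gp))"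
    unfolding R_elt_eq legs_indicator[OF unit_elt_H] T3.section_mult[OF leg_sections(3,1)]
    by (intro arg_cong[where f = indicator] image_cong)
      (auto simp: tgt_eta pair_cmp_def eta_closed eta_mult inv_mult_group m_assoc[symmetric])
  moreover have "R_elt \<in> elements (tensor2 H)"
    using T2.section_elements[OF R_sections(1)] by (simp add: R_elt_eq)
  ultimately show ?thesis
    unfolding quasitriangular_def using R_inverse R_intertwines left right by auto
qed

section \<open>Pseudotriangularity\<close>

text \<open>
  \<open>?L\<close> and \<open>?M\<close> are the sections of the two sides, \<open>?L'\<close> and \<open>?M'\<close> those of their first two
  factors. Agreement of the third components already forces invariance under conjugation, and
  invariance makes the other two components agree.
\<close>

lemma pseudotriangular_iff_conj:
  "pseudotriangular H R_elt \<longleftrightarrow> (\<forall>b\<in>Gp. \<forall>c\<in>Gp. \<eta> (c \<otimes> b \<otimes> inv c) = \<eta> b)"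
proof -
  let ?O = "Gp \<times> Gp \<times> Gp"
  let ?w = "\<lambda>a b. b \<otimes> a \<otimes> inv b"
  let ?L' = "\<lambda>(a, b, c). (a \<otimes> inv (\<eta> b), b, c \<otimes> \<eta> (?w a b))"
  let ?L = "\<lambda>(a, b, c). (a \<otimes> inv (\<eta> b), b \<otimes> inv (\<eta> (inv (?w a b) \<otimes> c \<otimes> ?w a b)), c \<otimes> \<eta> (?w a b))"
  let ?M' = "\<lambda>(a, b, c). (a, b \<otimes> inv (\<eta> c), c \<otimes> \<eta> a)"
  let ?M = "\<lambda>(a, b, c). (a \<otimes> inv (\<eta> (?w b c)), b \<otimes> inv (\<eta> c), c \<otimes> \<eta> a)"
  have sections: "T3.is_section ?O ?L'" "T3.is_section ?O ?L" "T3.is_section ?O ?M'" "T3.is_section ?O ?M"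
    by (auto simp: T3.is_section_def eta_closed)
  have "alg_mult (tensor3 H) (leg12 H R_elt) (leg31 H R_inv) = indicator (?L' ` ?O)"
    unfolding R_elt_eq R_inv_def legs_indicator[OF unit_elt_H] T3.section_mult[OF leg_sections(1,4)]
    by (intro arg_cong[where f = indicator] image_cong)
      (auto simp: tgt_eta pair_cmp_def eta_closed)
  moreover have "alg_mult (tensor3 H) (indicator (?L' ` ?O)) (leg23 H R_elt) = indicator (?L ` ?O)"
    unfolding R_elt_eq legs_indicator[OF unit_elt_H] T3.section_mult[OF sections(1) leg_sections(2)]
    by (intro arg_cong[where f = indicator] image_cong)
      (auto simp: tgt_eta pair_cmp_def eta_closed)
  moreover have "alg_mult (tensor3 H) (leg23 H R_elt) (leg31 H R_inv) = indicator (?M' ` ?O)"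
    unfolding R_elt_eq R_inv_def legs_indicator[OF unit_elt_H] T3.section_mult[OF leg_sections(2,4)]
    by (intro arg_cong[where f = indicator] image_cong)
      (auto simp: tgt_eta pair_cmp_def eta_closed)
  moreover have "alg_mult (tensor3 H) (indicator (?M' ` ?O)) (leg12 H R_elt) = indicator (?M ` ?O)"
    unfolding R_elt_eq legs_indicator[OF unit_elt_H] T3.section_mult[OF sections(3) leg_sections(1)]
    by (intro arg_cong[where f = indicator] image_cong)
      (auto simp: tgt_eta pair_cmp_def eta_closed)
  ultimately have "pseudotriangular H R_elt \<longleftrightarrow> (\<forall>i\<in>?O. ?L i = ?M i)"
    unfolding pseudotriangular_def Let_def T2.alg_inverse_eq[OF R_inverse]
    using R_quasitriangular T3.section_eq_iff[OF sections(2,4)] by simp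
  also have "\<dots> \<longleftrightarrow> (\<forall>b\<in>Gp. \<forall>c\<in>Gp. \<eta> (c \<otimes> b \<otimes> inv c) = \<eta> b)" (is "?X \<longleftrightarrow> ?Y")
  proof
    assume X: ?X
    show ?Y
    proof (intro ballI)
      fix b c assume bc: "b \<in> Gp" "c \<in> Gp"
      have "?L (b, c, \<one>) = ?M (b, c, \<one>)"
        using bc bspec[OF X, of "(b, c, \<one>)"] by simp
      then show "\<eta> (c \<otimes> b \<otimes> inv c) = \<eta> b" using bc by simp
    qed
  next
    assume Y: ?Y
    have "\<eta> (inv c \<otimes> b \<otimes> c) = \<eta> b" if "b \<in> Gp" "c \<in> Gp" for b c
      using Y[rule_format, of b "inv c"] that by simp
    with Y show ?X by auto
  qed
  finally show ?thesis .
qed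

lemma conj_invariant_iff_commuting:
  "(\<forall>b\<in>Gp. \<forall>c\<in>Gp. \<eta> (c \<otimes> b \<otimes> inv c) = \<eta> b) \<longleftrightarrow> (\<forall>u\<in>Gp. \<forall>v\<in>Gp. \<eta> (u \<otimes> v) = \<eta> (v \<otimes> u))"
  (is "?X \<longleftrightarrow> ?Y")
proof
  assume X: ?X
  show ?Y
  proof (intro ballI)
    fix u v assume uv: "u \<in> Gp" "v \<in> Gp"
    have "v \<otimes> (u \<otimes> v) \<otimes> inv v = v \<otimes> u" using uv by (simp add: m_assoc)
    with X[rule_format, of "u \<otimes> v" v] uv show "\<eta> (u \<otimes> v) = \<eta> (v \<otimes> u)" by simp
  qed
next
  assume Y: ?Y
  show ?X
  proof (intro ballI)
    fix b c assume bc: "b \<in> Gp" "c \<in> Gp"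
    have "inv c \<otimes> (c \<otimes> b) = b" using bc by (simp add: m_assoc[symmetric])
    with Y[rule_format, of "c \<otimes> b" "inv c"] bc show "\<eta> (c \<otimes> b \<otimes> inv c) = \<eta> b" by simp
  qed
qed

end

theorem theorem4p4:
  fixes G :: "('a, 'm) monoid_scheme" and Gp Gm :: "'a set" and \<xi> \<eta> :: "'a \<Rightarrow> 'a"
  assumes "unique_factorization G Gp Gm"
    and "finite (carrier G)"
    and "positive_quasitriangular_pair G Gp Gm \<xi> \<eta>"
    and "normal_pair G Gp \<xi>"
  shows "pseudotriangular (factorization_hopf G Gp Gm) (R_mat G Gp Gm \<xi> \<eta>) \<longleftrightarrow>
         (\<forall>u\<in>Gp. \<forall>v\<in>Gp. \<eta> (u \<otimes>\<^bsub>G\<^esub> v) = \<eta> (v \<otimes>\<^bsub>G\<^esub> u))"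
proof -
  interpret crossed_module_factorization G Gp Gm \<eta>
    using assms(2-4) by (rule normal_pair_crossed_module)
  have "R_mat G Gp Gm \<xi> \<eta> = R_elt"
    using assms(4) by (simp add: R_elt_def R_mat_def normal_pair_def)
  then show ?thesis
    using pseudotriangular_iff_conj conj_invariant_iff_commuting by (simp add: H_def)
qed

end
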